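(* Let $f\in\mathbb{R}[\boldsymbol{x}]$, let $\boldsymbol{G}\in\mathbb{S}^{n+m}[\boldsymbol{x}]$ be an arrow-type polynomial matrix (see context), let $\mathcal{K}=\{\boldsymbol{x}\in\mathbb{R}^{n_x}:\boldsymbol{G}(\boldsymbol{x})\succeq0\}$ be compact, and let $f^*=\min_{\boldsymbol{x}\in\mathcal{K}}f(\boldsymbol{x})$. Assume: (1) (Archimedean condition) there exist an SOS polynomial $p_0$ on $\mathbb{R}^{n_x}$ and an SOS matrix polynomial $\boldsymbol{R}:\mathbb{R}^{n_x}\to\mathbb{S}^{n+m}$ such that $\{\boldsymbol{x}\in\mathbb{R}^{n_x}:p_0(\boldsymbol{x})+\langle\boldsymbol{R}(\boldsymbol{x}),\boldsymbol{G}(\boldsymbol{x})\rangle\ge0\}$ is compact; (2) for all $\boldsymbol{x}\in\mathcal{K}$ and $k\in[p]$, $\boldsymbol{A}_k(\boldsymbol{x})\succeq0$ and $\boldsymbol{\Gamma}(\boldsymbol{x})\succeq0$. Let $f_{\mathrm{AD}}$ be the infimum of $f(\boldsymbol{x})$ over all $\boldsymbol{x}\in\mathbb{R}^{n_x}$, $\boldsymbol{D}\in\mathbb{R}^{n_{\mathcal{I}}\times m}$ and $\boldsymbol{C}_1,\dots,\boldsymbol{C}_{p-1}\in\mathbb{S}^m$ satisfying $$\boldsymbol{G}_k(\boldsymbol{x})+\begin{pmatrix}\boldsymbol{0}&\boldsymbol{\Pi}_k\boldsymbol{D}\\\boldsymbol{D}^T\boldsymbol{\Pi}_k^T&\boldsymbol{C}_k\end{pmatrix}\succeq0,\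 k\in[p-1],\qquad \boldsymbol{G}_p(\boldsymbol{x})+\begin{pmatrix}\boldsymbol{0}&\boldsymbol{\Pi}_p\boldsymbol{D}\\\boldsymbol{D}^T\boldsymbol{\Pi}_p^T&\boldsymbol{\Gamma}(\boldsymbol{x})-\sum_{k=1}^{p-1}\boldsymbol{C}_k\end{pmatrix}\succeq0.$$ Then $f_{\mathrm{AD}}=f^*$.
   Context: $[p]=\{1,\dots,p\}$; $\mathbb{S}^n$ denotes real symmetric $n\times n$ matrices and $\mathbb{S}^n[\boldsymbol{x}]$, $\mathbb{R}^{n\times m}[\boldsymbol{x}]$ the symmetric, resp. rectangular, matrices with entries polynomial in $\boldsymbol{x}\in\mathbb{R}^{n_x}$. A matrix polynomial $\boldsymbol{R}\in\mathbb{S}^s[\boldsymbol{x}]$ is SOS if $\boldsymbol{R}=\boldsymbol{H}\boldsymbol{H}^T$ for some $\boldsymbol{H}\in\mathbb{R}^{s\times\ell}[\boldsymbol{x}]$. $\langle\cdot,\cdot\rangle$ is the trace inner product. Arrow-type polynomial matrix: $\boldsymbol{G}(\boldsymbol{x})=\sum_{k=1}^p\boldsymbol{G}_k(\boldsymbol{x})+\begin{bmatrix}\boldsymbol{0}&\boldsymbol{0}\\\boldsymbol{0}&\boldsymbol{\Gamma}(\boldsymbol{x})\end{bmatrix}$ with $\boldsymbol{G}_k=\begin{bmatrix}\boldsymbol{A}_k&\boldsymbol{B}_k\\\boldsymbol{B}_k^T&\boldsymbol{0}\end{bmatrix}$, $\boldsymbol{A}_k\in\mathbb{S}^n[\boldsymbol{x}]$,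 $\boldsymbol{B}_k\in\mathbb{R}^{n\times m}[\boldsymbol{x}]$, $\boldsymbol{\Gamma}\in\mathbb{S}^m[\boldsymbol{x}]$. Here $\mathcal{I}_k\subseteq[n]$ is the set of indices of the rows/columns of $\boldsymbol{A}_k$ that are not identically zero; these sets may overlap, $\bigcup_k\mathcal{I}_k=[n]$, and rows of $\boldsymbol{B}_k$ with index outside $\mathcal{I}_k$ are zero. For $k<\ell$, $\mathcal{I}_{k,\ell}=\mathcal{I}_k\cap\mathcal{I}_\ell$, and $n_{\mathcal{I}}=\sum_{k<\ell}|\mathcal{I}_{k,\ell}|$. Matrices $\boldsymbol{\Pi}_k$: write $\boldsymbol{D}\in\mathbb{R}^{n_{\mathcal{I}}\times m}$ as a vertical concatenation (in a fixed order of the pairs $k<\ell$) of blocks $\overline{\boldsymbol{D}}_{k,\ell}\in\mathbb{R}^{|\mathcal{I}_{k,\ell}|\times m}$, and let $\boldsymbol{D}_{k,\ell}\in\mathbb{R}^{n\times m}$ be the matrix whose rows indexed by $\mathcal{I}_{k,\ell}$ (in increasing order) are those of $\overline{\boldsymbol{D}}_{k,\ell}$ and whose other rows are zero. Then $\boldsymbol{\Pi}_k\in\mathbb{R}^{n\times n_{\mathcal{I}}}$ is the matrix with entries in $\{0,1,-1\}$ such that $\boldsymbol{\Pi}_k\boldsymbol{D}=-\sum_{\ell<k}\boldsymbol{D}_{\ell,k}+\sum_{\ell>k}\boldsymbol{D}_{k,\ell}$ for every $\boldsymbol{D}$. *)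

theory Defs
  imports "HOL-Analysis.Analysis" "Jordan_Normal_Form.Matrix"
begin

unbundle no inner_syntax
no_notation vec_nth (infixl \<open>$\<close> 90)

text \<open>
  Matrices are those of \<^theory>\<open>Jordan_Normal_Form.Matrix\<close>, whose dimensions are natural numbers;
  their row and column indices start at 0.  The blocks of an arrow-type matrix are indexed by
  \<open>{1..p}\<close>.  A matrix polynomial is represented by the function it induces.
\<close>

definition symmetric_mat :: "nat \<Rightarrow> real mat \<Rightarrow> bool" where
  "symmetric_mat s M \<longleftrightarrow> M \<in> carrier_mat s s \<and> transpose_mat M = M"

definition psd_mat :: "nat \<Rightarrow> real mat \<Rightarrow> bool" where
  "psd_mat s M \<longleftrightarrow>
     symmetric_mat s M \<and> (\<forall>v \<in> carrier_vec s. 0 \<le> v \<bullet> (M *\<^sub>v v))"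

definition trace_inner :: "real mat \<Rightarrow> real mat \<Rightarrow> real" where
  "trace_inner M N = sum_list (diag_mat (transpose_mat M * N))"

definition mat_sum :: "nat \<Rightarrow> nat \<Rightarrow> ('k \<Rightarrow> real mat) \<Rightarrow> 'k set \<Rightarrow> real mat" where
  "mat_sum r c M K = mat r c (\<lambda>ij. \<Sum>k\<in>K. M k $$ ij)"

definition matrix_polynomial ::
  "nat \<Rightarrow> nat \<Rightarrow> ('x::real_normed_vector \<Rightarrow> real mat) \<Rightarrow> bool" where
  "matrix_polynomial r c M \<longleftrightarrow>
     (\<forall>x. M x \<in> carrier_mat r c) \<and>
     (\<forall>i<r. \<forall>j<c. real_polynomial_function (\<lambda>x. M x $$ (i, j)))"

definition symmetric_matrix_polynomial ::
  "nat \<Rightarrow> ('x::real_normed_vector \<Rightarrow> real mat) \<Rightarrow> bool" where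
  "symmetric_matrix_polynomial s M \<longleftrightarrow>
     matrix_polynomial s s M \<and> (\<forall>x. symmetric_mat s (M x))"

definition sos_matrix_polynomial ::
  "nat \<Rightarrow> ('x::real_normed_vector \<Rightarrow> real mat) \<Rightarrow> bool" where
  "sos_matrix_polynomial s R \<longleftrightarrow>
     (\<exists>l H. matrix_polynomial s l H \<and> (\<forall>x. R x = H x * transpose_mat (H x)))"

definition sos_polynomial :: "('x::real_normed_vector \<Rightarrow> real) \<Rightarrow> bool" where
  "sos_polynomial q \<longleftrightarrow>
     (\<exists>l h. (\<forall>i<l. real_polynomial_function (h i)) \<and> (\<forall>x. q x = (\<Sum>i<(l::nat). (h i x)\<^sup>2)))"


definition arrow_block ::
  "nat \<Rightarrow> ('x \<Rightarrow> real mat) \<Rightarrow> ('x \<Rightarrow> real mat) \<Rightarrow> 'x \<Rightarrow> real mat" where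
  "arrow_block m A B x = four_block_mat (A x) (B x) (transpose_mat (B x)) (0\<^sub>m m m)"

definition arrow_mat ::
  "nat \<Rightarrow> nat \<Rightarrow> nat \<Rightarrow> (nat \<Rightarrow> 'x \<Rightarrow> real mat) \<Rightarrow> (nat \<Rightarrow> 'x \<Rightarrow> real mat) \<Rightarrow> ('x \<Rightarrow> real mat)
    \<Rightarrow> 'x \<Rightarrow> real mat" where
  "arrow_mat n m p A B \<Gamma> x =
     mat_sum (n + m) (n + m) (\<lambda>k. arrow_block m (A k) (B k) x) {1..p}
     + four_block_mat (0\<^sub>m n n) (0\<^sub>m n m) (0\<^sub>m m n) (\<Gamma> x)"

definition row_support :: "nat \<Rightarrow> ('x \<Rightarrow> real mat) \<Rightarrow> nat set" where
  "row_support n A = {i. i < n \<and> (\<exists>j<n. \<exists>x. A x $$ (i, j) \<noteq> 0)}"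

definition arrow_data ::
  "nat \<Rightarrow> nat \<Rightarrow> nat \<Rightarrow> (nat \<Rightarrow> 'x::real_normed_vector \<Rightarrow> real mat) \<Rightarrow> (nat \<Rightarrow> 'x \<Rightarrow> real mat)
    \<Rightarrow> ('x \<Rightarrow> real mat) \<Rightarrow> bool" where
  "arrow_data n m p A B \<Gamma> \<longleftrightarrow>
     1 \<le> p \<and>
     (\<forall>k\<in>{1..p}. symmetric_matrix_polynomial n (A k)) \<and>
     (\<forall>k\<in>{1..p}. matrix_polynomial n m (B k)) \<and>
     symmetric_matrix_polynomial m \<Gamma> \<and>
     (\<Union>k\<in>{1..p}. row_support n (A k)) = {..<n} \<and>
     (\<forall>k\<in>{1..p}. \<forall>i\<in>{..<n} - row_support n (A k). \<forall>j<m. \<forall>x. B k x $$ (i, j) = 0)"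


definition pair_order :: "nat \<Rightarrow> (nat \<times> nat) list \<Rightarrow> bool" where
  "pair_order p ps \<longleftrightarrow> distinct ps \<and> set ps = {(k, l). 1 \<le> k \<and> k < l \<and> l \<le> p}"

definition overlap :: "(nat \<Rightarrow> nat set) \<Rightarrow> nat \<times> nat \<Rightarrow> nat set" where
  "overlap I = (\<lambda>(k, l). I k \<inter> I l)"

definition overlap_total :: "(nat \<Rightarrow> nat set) \<Rightarrow> nat \<Rightarrow> nat" where
  "overlap_total I p = (\<Sum>kl\<in>{(k, l). 1 \<le> k \<and> k < l \<and> l \<le> p}. card (overlap I kl))"

text \<open>The block for the pair \<open>kl\<close> starts below the blocks of all pairs preceding it in \<open>ps\<close>.\<close>

definition block_offset :: "(nat \<Rightarrow> nat set) \<Rightarrow> (nat \<times> nat) list \<Rightarrow> nat \<times> nat \<Rightarrow> nat" where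
  "block_offset I ps kl = sum_list (map (\<lambda>q. card (overlap I q)) (takeWhile (\<lambda>q. q \<noteq> kl) ps))"

definition compressed_block ::
  "nat \<Rightarrow> (nat \<Rightarrow> nat set) \<Rightarrow> (nat \<times> nat) list \<Rightarrow> real mat \<Rightarrow> nat \<times> nat \<Rightarrow> real mat" where
  "compressed_block m I ps D kl =
     mat (card (overlap I kl)) m (\<lambda>(r, j). D $$ (block_offset I ps kl + r, j))"

text \<open>For \<open>i \<in> S\<close> the number \<open>card {i' \<in> S. i' < i}\<close> is the position of \<open>i\<close> in the increasing
  enumeration of \<open>S\<close>.\<close>

definition expanded_block ::
  "nat \<Rightarrow> nat \<Rightarrow> (nat \<Rightarrow> nat set) \<Rightarrow> (nat \<times> nat) list \<Rightarrow> real mat \<Rightarrow> nat \<times> nat \<Rightarrow> real mat" where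
  "expanded_block n m I ps D kl =
     mat n m (\<lambda>(i, j). if i \<in> overlap I kl
       then compressed_block m I ps D kl $$ (card {i' \<in> overlap I kl. i' < i}, j) else 0)"

definition coupling_mat ::
  "nat \<Rightarrow> nat \<Rightarrow> nat \<Rightarrow> (nat \<Rightarrow> nat set) \<Rightarrow> (nat \<times> nat) list \<Rightarrow> nat \<Rightarrow> real mat \<Rightarrow> bool" where
  "coupling_mat n m p I ps k P \<longleftrightarrow>
     P \<in> carrier_mat n (overlap_total I p) \<and> elements_mat P \<subseteq> {0, 1, - 1} \<and>
     (\<forall>D \<in> carrier_mat (overlap_total I p) m.
        P * D = - mat_sum n m (\<lambda>l. expanded_block n m I ps D (l, k)) {1..<k}
                + mat_sum n m (\<lambda>l. expanded_block n m I ps D (k, l)) {k<..p})"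


definition block_position :: "(nat \<Rightarrow> nat set) \<Rightarrow> (nat \<times> nat) list \<Rightarrow> nat \<times> nat \<Rightarrow> nat \<Rightarrow> nat" where
  "block_position I ps kl i = block_offset I ps kl + card {i' \<in> overlap I kl. i' < i}"

lemma block_offset_Cons:
  "block_offset I (q # ps) kl = (if q = kl then 0 else card (overlap I q) + block_offset I ps kl)"
  by (simp add: block_offset_def)

lemma block_offset_bound:
  "kl \<in> set ps \<Longrightarrow>
     block_offset I ps kl + card (overlap I kl) \<le> sum_list (map (\<lambda>q. card (overlap I q)) ps)"
  by (induction ps) (auto simp: block_offset_Cons)

lemma block_offset_disjoint:
  "kl \<in> set ps \<Longrightarrow> kl' \<in> set ps \<Longrightarrow> kl \<noteq> kl' \<Longrightarrow>
     block_offset I ps kl + card (overlap I kl) \<le> block_offset I ps kl' \<or>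
     block_offset I ps kl' + card (overlap I kl') \<le> block_offset I ps kl"
  by (induction ps) (auto simp: block_offset_Cons)

lemma overlap_total_sum_list:
  "pair_order p ps \<Longrightarrow> overlap_total I p = sum_list (map (\<lambda>q. card (overlap I q)) ps)"
  unfolding pair_order_def overlap_total_def
  by (metis sum_list_distinct_conv_sum_set)

lemma rank_less_card:
  "finite S \<Longrightarrow> i \<in> S \<Longrightarrow> card {i' \<in> S. i' < (i::nat)} < card S"
  by (rule psubset_card_mono) auto

lemma coupling_mat_exists:
  assumes ps: "pair_order p ps" and k: "k \<in> {1..p}"
    and I: "\<And>k. k \<in> {1..p} \<Longrightarrow> I k \<subseteq> {..<n}"
  shows "\<exists>P. coupling_mat n m p I ps k P"
proof -
  define N where "N = overlap_total I p"
  define \<delta> where "\<delta> = (\<lambda>i c kl. if i \<in> overlap I kl \<and> c = block_position I ps kl i then 1 else (0::real))"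
  define P where "P = mat n N (\<lambda>(i, c). (\<Sum>l\<in>{k<..p}. \<delta> i c (k, l)) - (\<Sum>l\<in>{1..<k}. \<delta> i c (l, k)))"
  have in_ps: "(a, b) \<in> set ps \<longleftrightarrow> 1 \<le> a \<and> a < b \<and> b \<le> p" for a b
    using ps by (simp add: pair_order_def)
  have fin: "finite (overlap I kl)" if "kl \<in> set ps" for kl
  proof -
    obtain a b where kl: "kl = (a, b)" by (cases kl)
    with that have "a \<in> {1..p}" using in_ps[of a b] by auto
    from finite_subset[OF I[OF this]] show ?thesis by (simp add: kl overlap_def)
  qed
  have pos: "block_position I ps kl i < block_offset I ps kl + card (overlap I kl)"
    if "kl \<in> set ps" "i \<in> overlap I kl" for kl i
    using rank_less_card[OF fin[OF that(1)] that(2)] by (simp add: block_position_def)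
  have posN: "block_position I ps kl i < N" if "kl \<in> set ps" "i \<in> overlap I kl" for kl i
    using pos[OF that] block_offset_bound[OF that(1), of I]
    by (simp add: N_def overlap_total_sum_list[OF ps])
  have uniq: "kl = kl'" if "kl \<in> set ps" "kl' \<in> set ps" "\<delta> i c kl \<noteq> 0" "\<delta> i c kl' \<noteq> 0" for i c kl kl'
  proof (rule ccontr)
    assume "kl \<noteq> kl'"
    have a: "i \<in> overlap I kl" "i \<in> overlap I kl'"
        "block_position I ps kl i = block_position I ps kl' i"
      using that(3,4) by (auto simp: \<delta>_def split: if_splits)
    have "block_offset I ps kl \<le> block_position I ps kl i"
      "block_offset I ps kl' \<le> block_position I ps kl' i" by (auto simp: block_position_def)
    with pos[OF that(1) a(1)] pos[OF that(2) a(2)] a(3)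
      block_offset_disjoint[OF that(1,2) \<open>kl \<noteq> kl'\<close>, of I]
    show False by linarith
  qed
  have \<delta>01: "\<delta> i c kl = 0 \<or> \<delta> i c kl = 1" for i c kl
    by (simp add: \<delta>_def)
  have entry: "(\<Sum>l\<in>{k<..p}. \<delta> i c (k, l)) - (\<Sum>l\<in>{1..<k}. \<delta> i c (l, k)) \<in> {0, 1, - 1}" for i c
  proof -
    consider (none) "\<forall>l\<in>{k<..p}. \<delta> i c (k, l) = 0" "\<forall>l\<in>{1..<k}. \<delta> i c (l, k) = 0"
      | (up) l0 where "l0 \<in> {k<..p}" "\<delta> i c (k, l0) \<noteq> 0"
      | (low) l0 where "l0 \<in> {1..<k}" "\<delta> i c (l0, k) \<noteq> 0" by blast
    then show ?thesis
    proof cases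
      case none
      then show ?thesis by simp
    next
      case up
      have "\<delta> i c (l, k) = 0" if l: "l \<in> {1..<k}" for l
      proof -
        have "(l, k) \<in> set ps" "(k, l0) \<in> set ps" using l up(1) k by (simp_all add: in_ps)
        moreover have "(l, k) \<noteq> (k, l0)" using l by auto
        ultimately show ?thesis using uniq[of "(l, k)" "(k, l0)" i c] up(2) by blast
      qed
      moreover have "\<delta> i c (k, l) = (if l = l0 then 1 else 0)" if l: "l \<in> {k<..p}" for l
      proof (cases "l = l0")
        case True
        then show ?thesis using up(2) \<delta>01[of i c "(k, l0)"] by simp
      next
        case False
        have "(k, l) \<in> set ps" "(k, l0) \<in> set ps" using l up(1) k by (simp_all add: in_ps)
        with uniq[of "(k, l)" "(k, l0)" i c] up(2) False have "\<delta> i c (k, l) = 0" by blast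
        then show ?thesis using False by simp
      qed
      ultimately show ?thesis using up(1) by simp
    next
      case low
      have "\<delta> i c (k, l) = 0" if l: "l \<in> {k<..p}" for l
      proof -
        have "(k, l) \<in> set ps" "(l0, k) \<in> set ps" using l low(1) k by (simp_all add: in_ps)
        moreover have "(k, l) \<noteq> (l0, k)" using l by auto
        ultimately show ?thesis using uniq[of "(k, l)" "(l0, k)" i c] low(2) by blast
      qed
      moreover have "\<delta> i c (l, k) = (if l = l0 then 1 else 0)" if l: "l \<in> {1..<k}" for l
      proof (cases "l = l0")
        case True
        then show ?thesis using low(2) \<delta>01[of i c "(l0, k)"] by simp
      next
        case False
        have "(l, k) \<in> set ps" "(l0, k) \<in> set ps" using l low(1) k by (simp_all add: in_ps)
        with uniq[of "(l, k)" "(l0, k)" i c] low(2) False have "\<delta> i c (l, k) = 0" by blast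
        then show ?thesis using False by simp
      qed
      ultimately show ?thesis using low(1) by simp
    qed
  qed
  have blk: "(\<Sum>c<N. \<delta> i c kl * D $$ (c, j)) = expanded_block n m I ps D kl $$ (i, j)"
    if "kl \<in> set ps" "i < n" "j < m" for i j kl and D :: "real mat"
  proof (cases "i \<in> overlap I kl")
    case True
    have "(\<Sum>c<N. \<delta> i c kl * D $$ (c, j)) =
        (\<Sum>c<N. if c = block_position I ps kl i then D $$ (c, j) else 0)"
      using True by (intro sum.cong) (auto simp: \<delta>_def)
    also have "\<dots> = D $$ (block_position I ps kl i, j)"
      using posN[OF that(1) True] by simp
    finally show ?thesis
      using True that rank_less_card[OF fin[OF that(1)] True]
      by (simp add: expanded_block_def compressed_block_def block_position_def)
  next
    case False
    then show ?thesis using that by (simp add: \<delta>_def expanded_block_def)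
  qed
  have "coupling_mat n m p I ps k P"
    unfolding coupling_mat_def N_def[symmetric]
  proof (intro conjI ballI)
    show "P \<in> carrier_mat n N" by (simp add: P_def)
    show "elements_mat P \<subseteq> {0, 1, - 1}"
    proof
      fix a
      assume "a \<in> elements_mat P"
      then obtain i c where "i < n" "c < N" "a = P $$ (i, c)"
        by (auto simp: elements_mat_def P_def)
      then show "a \<in> {0, 1, - 1}" using entry[of i c] by (simp only: P_def index_mat split)
    qed
    fix D :: "real mat"
    assume D: "D \<in> carrier_mat N m"
    show "P * D = - mat_sum n m (\<lambda>l. expanded_block n m I ps D (l, k)) {1..<k}
                + mat_sum n m (\<lambda>l. expanded_block n m I ps D (k, l)) {k<..p}"
    proof (rule eq_matI)
      fix i j
      assume "i < dim_row (- mat_sum n m (\<lambda>l. expanded_block n m I ps D (l, k)) {1..<k}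
                + mat_sum n m (\<lambda>l. expanded_block n m I ps D (k, l)) {k<..p})"
        and "j < dim_col (- mat_sum n m (\<lambda>l. expanded_block n m I ps D (l, k)) {1..<k}
                + mat_sum n m (\<lambda>l. expanded_block n m I ps D (k, l)) {k<..p})"
      then have ij: "i < n" "j < m" by (auto simp: mat_sum_def)
      have "(P * D) $$ (i, j) = (\<Sum>c<N. P $$ (i, c) * D $$ (c, j))"
        using ij D by (auto simp: P_def scalar_prod_def lessThan_atLeast0 intro!: sum.cong)
      also have "\<dots> = (\<Sum>c<N. (\<Sum>l\<in>{k<..p}. \<delta> i c (k, l) * D $$ (c, j))
          - (\<Sum>l\<in>{1..<k}. \<delta> i c (l, k) * D $$ (c, j)))"
        using ij by (intro sum.cong) (auto simp: P_def left_diff_distrib sum_distrib_right)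
      also have "\<dots> = (\<Sum>l\<in>{k<..p}. \<Sum>c<N. \<delta> i c (k, l) * D $$ (c, j))
          - (\<Sum>l\<in>{1..<k}. \<Sum>c<N. \<delta> i c (l, k) * D $$ (c, j))"
        unfolding sum_subtractf by (intro arg_cong2[where f = "(-)"] sum.swap)
      also have "\<dots> = (\<Sum>l\<in>{k<..p}. expanded_block n m I ps D (k, l) $$ (i, j))
          - (\<Sum>l\<in>{1..<k}. expanded_block n m I ps D (l, k) $$ (i, j))"
        using ij k by (intro arg_cong2[where f = "(-)"] sum.cong refl blk) (auto simp: in_ps)
      finally show "(P * D) $$ (i, j) = (- mat_sum n m (\<lambda>l. expanded_block n m I ps D (l, k)) {1..<k}
                + mat_sum n m (\<lambda>l. expanded_block n m I ps D (k, l)) {k<..p}) $$ (i, j)"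
        using ij by (simp add: mat_sum_def)
    qed (use D in \<open>auto simp: P_def mat_sum_def\<close>)
  qed
  then show ?thesis by blast
qed


definition AD_feasible ::
  "nat \<Rightarrow> nat \<Rightarrow> nat \<Rightarrow> (nat \<Rightarrow> 'x \<Rightarrow> real mat) \<Rightarrow> (nat \<Rightarrow> 'x \<Rightarrow> real mat) \<Rightarrow> ('x \<Rightarrow> real mat)
    \<Rightarrow> (nat \<Rightarrow> real mat) \<Rightarrow> 'x \<Rightarrow> real mat \<Rightarrow> (nat \<Rightarrow> real mat) \<Rightarrow> bool" where
  "AD_feasible n m p A B \<Gamma> Pm x D C \<longleftrightarrow>
     D \<in> carrier_mat (overlap_total (\<lambda>k. row_support n (A k)) p) m \<and>
     (\<forall>k\<in>{1..<p}. symmetric_mat m (C k)) \<and>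
     (\<forall>k\<in>{1..<p}. psd_mat (n + m)
        (arrow_block m (A k) (B k) x
         + four_block_mat (0\<^sub>m n n) (Pm k * D)
             (transpose_mat D * transpose_mat (Pm k)) (C k))) \<and>
     psd_mat (n + m)
       (arrow_block m (A p) (B p) x
        + four_block_mat (0\<^sub>m n n) (Pm p * D)
            (transpose_mat D * transpose_mat (Pm p)) (\<Gamma> x - mat_sum m m C {1..<p}))"

text \<open>The infimum is taken in the extended reals, with value \<open>\<infinity>\<close> if nothing is feasible.\<close>

definition f_AD ::
  "nat \<Rightarrow> nat \<Rightarrow> nat \<Rightarrow> (nat \<Rightarrow> 'x \<Rightarrow> real mat) \<Rightarrow> (nat \<Rightarrow> 'x \<Rightarrow> real mat) \<Rightarrow> ('x \<Rightarrow> real mat)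
    \<Rightarrow> (nat \<Rightarrow> real mat) \<Rightarrow> ('x \<Rightarrow> real) \<Rightarrow> ereal" where
  "f_AD n m p A B \<Gamma> Pm f = Inf {ereal (f x) | x D C. AD_feasible n m p A B \<Gamma> Pm x D C}"

end

theory Submission
  imports Defs
begin

text \<open>
  The two problems have the same feasible points \<open>x\<close>, so their values agree; the decomposition can
  be found separately at each point.

  Feasibility of a decomposition at \<open>x\<close> implies \<open>x \<in> K\<close>, since adding up all the coupled blocks gives
  \<open>G(x)\<close>: each block of \<open>D\<close> enters two of the products \<open>\<Pi>\<^sub>k D\<close> with opposite signs
  (\<open>coupling_mats_sum_zero\<close>), and the lower right corners add up to \<open>\<Gamma>(x)\<close>.

  Conversely, let \<open>x \<in> K\<close> and put \<open>A = \<Sum>\<^sub>k A\<^sub>k(x)\<close>, \<open>B = \<Sum>\<^sub>k B\<^sub>k(x)\<close>.  As \<open>G(x)\<close> has the blocks \<open>A\<close>, \<open>B\<close>,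
  \<open>\<Gamma>(x)\<close> and is positive semidefinite, the columns of \<open>B\<close> lie in the range of \<open>A\<close>
  (\<open>psd_four_block_range\<close>): there is an \<open>X\<close> with \<open>A X = B\<close>, and \<open>\<Gamma>(x) - X\<^sup>T A X\<close> is positive
  semidefinite (\<open>schur_complement_psd\<close>).  Now let the \<open>k\<close>-th block have the off-diagonal part \<open>A\<^sub>k(x) X\<close>
  and the lower right corner \<open>X\<^sup>T A\<^sub>k(x) X\<close>, and give the remaining slack \<open>\<Gamma>(x) - X\<^sup>T A X\<close> to the last
  block.  Each block is then positive semidefinite because \<open>A\<^sub>k(x)\<close> is
  (\<open>psd_four_block_completion\<close>).

  What is left is to write the corrections \<open>E\<^sub>k = A\<^sub>k(x) X - B\<^sub>k(x)\<close> as \<open>\<Pi>\<^sub>k D\<close> for one common \<open>D\<close>.  They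
  sum to zero, and row \<open>i\<close> of \<open>E\<^sub>k\<close> vanishes unless \<open>i\<close> is in the support of \<open>A\<^sub>k\<close>.  For fixed \<open>i\<close>, view
  the blocks supporting \<open>i\<close> as the vertices of a complete graph and the entries of \<open>D\<close> as flows along
  its edges; a vertex demand with zero sum is always met by some flow, for instance one along a star
  (\<open>coupling_mats_realize\<close>).
\<close>

section \<open>Positive semidefinite block matrices\<close>

text \<open>
  A functional vanishing on the common kernel of finitely many functionals is a linear combination of
  them.  The claim is made for an arbitrary subspace \<open>V\<close> so that the induction over the number of
  functionals can pass to the kernel of the last one.
\<close>
lemma functional_in_span:
  fixes r :: "nat \<Rightarrow> real vec"
  assumes "\<And>i. i < q \<Longrightarrow> r i \<in> carrier_vec n" and "b \<in> carrier_vec n"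
    and "V \<subseteq> carrier_vec n" and "\<And>u v t. u \<in> V \<Longrightarrow> v \<in> V \<Longrightarrow> u + t \<cdot>\<^sub>v v \<in> V"
    and "\<And>v. v \<in> V \<Longrightarrow> \<forall>i<q. r i \<bullet> v = 0 \<Longrightarrow> b \<bullet> v = 0"
  shows "\<exists>c. \<forall>v\<in>V. b \<bullet> v = (\<Sum>i<q. c i * (r i \<bullet> v))"
  using assms
proof (induction q arbitrary: V)
  case 0
  then show ?case by simp
next
  case (Suc q)
  note r = Suc.prems(1) and b = Suc.prems(2) and V = Suc.prems(3) and comb = Suc.prems(4)
  define W where "W = {v \<in> V. r q \<bullet> v = 0}"
  have lin: "s \<bullet> (u + t \<cdot>\<^sub>v v) = s \<bullet> u + t * (s \<bullet> v)"
    if "s \<in> carrier_vec n" "u \<in> V" "v \<in> V" for s u v t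
    using that V by (simp add: subset_iff scalar_prod_add_distrib[where n = n])
  have "\<exists>c. \<forall>v\<in>W. b \<bullet> v = (\<Sum>i<q. c i * (r i \<bullet> v))"
  proof (rule Suc.IH)
    show "u + t \<cdot>\<^sub>v v \<in> W" if "u \<in> W" "v \<in> W" for u v t
      using that comb r by (auto simp: W_def lin)
    show "b \<bullet> v = 0" if "v \<in> W" "\<forall>i<q. r i \<bullet> v = 0" for v
      using that Suc.prems(5) by (auto simp: W_def less_Suc_eq)
  qed (use r b V in \<open>auto simp: W_def\<close>)
  then obtain c where c: "\<And>v. v \<in> W \<Longrightarrow> b \<bullet> v = (\<Sum>i<q. c i * (r i \<bullet> v))" by blast
  \<comment> \<open>The combination for \<open>W\<close> leaves a remainder \<open>h\<close> that vanishes on the kernel of \<open>r q\<close> in \<open>V\<close>, and is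
    therefore a multiple of \<open>r q\<close>.\<close>
  define h where "h v = b \<bullet> v - (\<Sum>i<q. c i * (r i \<bullet> v))" for v
  have h_lin: "h (u + t \<cdot>\<^sub>v v) = h u + t * h v" if "u \<in> V" "v \<in> V" for u v t
    using that b r by (simp add: h_def lin algebra_simps sum.distrib sum_distrib_left)
  have h_W: "h v = 0" if "v \<in> W" for v
    using c[OF that] by (simp add: h_def)
  have "\<exists>d. \<forall>v\<in>V. h v = d * (r q \<bullet> v)"
  proof (cases "V = W")
    case True
    then show ?thesis using h_W by (intro exI[of _ 0]) auto
  next
    case False
    then obtain v0 where v0: "v0 \<in> V" "r q \<bullet> v0 \<noteq> 0" by (auto simp: W_def)
    have "h v = h v0 / (r q \<bullet> v0) * (r q \<bullet> v)" if v: "v \<in> V" for v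
    proof -
      let ?t = "- (r q \<bullet> v) / (r q \<bullet> v0)"
      have "v + ?t \<cdot>\<^sub>v v0 \<in> W"
        using v v0 comb r[of q] by (simp add: W_def lin)
      from h_W[OF this] show ?thesis
        by (simp add: h_lin[OF v v0(1)])
    qed
    then show ?thesis by blast
  qed
  then obtain d where "\<forall>v\<in>V. h v = d * (r q \<bullet> v)" by blast
  then show ?case
    by (intro exI[of _ "c(q := d)"]) (auto simp: h_def algebra_simps)
qed

text \<open>
  The Fredholm alternative: the kernel of \<open>M\<close> is the common kernel of its rows, and a combination of
  the rows of \<open>M\<close> is a vector in the range of the transpose.
\<close>
lemma kernel_orthogonal_imp_range:
  fixes M :: "real mat"
  assumes M: "M \<in> carrier_mat q n" and b: "b \<in> carrier_vec n"
    and ker: "\<And>v. v \<in> carrier_vec n \<Longrightarrow> M *\<^sub>v v = 0\<^sub>v q \<Longrightarrow> b \<bullet> v = 0"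
  shows "\<exists>u\<in>carrier_vec q. transpose_mat M *\<^sub>v u = b"
proof -
  have "\<exists>c. \<forall>v\<in>carrier_vec n. b \<bullet> v = (\<Sum>i<q. c i * (row M i \<bullet> v))"
  proof (rule functional_in_span)
    show "b \<bullet> v = 0" if "v \<in> carrier_vec n" "\<forall>i<q. row M i \<bullet> v = 0" for v
      using that M by (intro ker) (auto intro!: eq_vecI)
  qed (use M b in auto)
  then obtain c where c: "\<And>v. v \<in> carrier_vec n \<Longrightarrow> b \<bullet> v = (\<Sum>i<q. c i * (row M i \<bullet> v))"
    by blast
  have u: "vec q c \<in> carrier_vec q" by simp
  have "b \<bullet> v = (transpose_mat M *\<^sub>v vec q c) \<bullet> v" if v: "v \<in> carrier_vec n" for v
  proof -
    have "b \<bullet> v = vec q c \<bullet> (M *\<^sub>v v)"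
      using c[OF v] M by (simp add: scalar_prod_def lessThan_atLeast0)
    also have "\<dots> = (transpose_mat M *\<^sub>v vec q c) \<bullet> v"
      using transpose_vec_mult_scalar[OF M v u] by simp
    finally show ?thesis .
  qed
  then have "(transpose_mat M *\<^sub>v vec q c) $ i = b $ i" if "i < n" for i
    using that M b by (metis mult_mat_vec_carrier scalar_prod_right_unit transpose_carrier_mat u
        unit_vec_carrier)
  then have "transpose_mat M *\<^sub>v vec q c = b"
    using M b by (intro eq_vecI) auto
  with u show ?thesis by blast
qed

lemma quadratic_form_four_block:
  fixes A :: "real mat"
  assumes "A \<in> carrier_mat n n" "B \<in> carrier_mat n m" "C \<in> carrier_mat m m"
    and "u \<in> carrier_vec n" "w \<in> carrier_vec m"
  shows "(u @\<^sub>v w) \<bullet> (four_block_mat A B (transpose_mat B) C *\<^sub>v (u @\<^sub>v w))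
    = u \<bullet> (A *\<^sub>v u) + 2 * (u \<bullet> (B *\<^sub>v w)) + w \<bullet> (C *\<^sub>v w)"
proof -
  have "four_block_mat A B (transpose_mat B) C *\<^sub>v (u @\<^sub>v w)
      = (A *\<^sub>v u + B *\<^sub>v w) @\<^sub>v (transpose_mat B *\<^sub>v u + C *\<^sub>v w)"
    using assms by (intro four_block_mat_mult_vec) auto
  moreover have "w \<bullet> (transpose_mat B *\<^sub>v u) = u \<bullet> (B *\<^sub>v w)"
    using assms transpose_vec_mult_scalar[of B n m w u]
    by (simp add: comm_scalar_prod[of w m])
  ultimately show ?thesis
    using assms
    by (simp add: scalar_prod_append[of _ n _ m] scalar_prod_add_distrib[of _ n]
        scalar_prod_add_distrib[of _ m])
qed

lemma symmetric_four_block_iff: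
  assumes "A \<in> carrier_mat n n" "B \<in> carrier_mat n m" "C \<in> carrier_mat m m"
  shows "symmetric_mat (n + m) (four_block_mat A B (transpose_mat B) C)
    \<longleftrightarrow> symmetric_mat n A \<and> symmetric_mat m C"
proof -
  have t: "transpose_mat (four_block_mat A B (transpose_mat B) C)
      = four_block_mat (transpose_mat A) B (transpose_mat B) (transpose_mat C)"
    using assms transpose_four_block_mat[of A n n B m "transpose_mat B" m C] by simp
  have "four_block_mat (transpose_mat A) B (transpose_mat B) (transpose_mat C)
      = four_block_mat A B (transpose_mat B) C \<longleftrightarrow> transpose_mat A = A \<and> transpose_mat C = C"
    (is "?L = ?R \<longleftrightarrow> _")
  proof
    assume eq: "?L = ?R"
    have "transpose_mat A $$ (i, j) = A $$ (i, j)" if "i < n" "j < n" for i j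
      using arg_cong[OF eq, of "\<lambda>M. M $$ (i, j)"] assms that by simp
    moreover have "transpose_mat C $$ (i, j) = C $$ (i, j)" if "i < m" "j < m" for i j
      using arg_cong[OF eq, of "\<lambda>M. M $$ (n + i, n + j)"] assms that by simp
    ultimately show "transpose_mat A = A \<and> transpose_mat C = C"
      using assms by (auto intro!: eq_matI)
  qed auto
  then show ?thesis using assms by (auto simp: symmetric_mat_def t)
qed

lemma psd_four_block_iff:
  assumes "A \<in> carrier_mat n n" "B \<in> carrier_mat n m" "C \<in> carrier_mat m m"
  shows "psd_mat (n + m) (four_block_mat A B (transpose_mat B) C)
    \<longleftrightarrow> symmetric_mat n A \<and> symmetric_mat m C \<and>
      (\<forall>u\<in>carrier_vec n. \<forall>w\<in>carrier_vec m.
         0 \<le> u \<bullet> (A *\<^sub>v u) + 2 * (u \<bullet> (B *\<^sub>v w)) + w \<bullet> (C *\<^sub>v w))"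
proof -
  let ?M = "four_block_mat A B (transpose_mat B) C"
  have "(\<forall>v\<in>carrier_vec (n + m). 0 \<le> v \<bullet> (?M *\<^sub>v v))
    \<longleftrightarrow> (\<forall>u\<in>carrier_vec n. \<forall>w\<in>carrier_vec m. 0 \<le> (u @\<^sub>v w) \<bullet> (?M *\<^sub>v (u @\<^sub>v w)))"
    by (auto simp: all_vec_append)
  then show ?thesis
    using assms by (simp add: psd_mat_def symmetric_four_block_iff quadratic_form_four_block)
qed

text \<open>
  If \<open>A v = 0\<close>, the quadratic form at \<open>(s v, w)\<close> is affine in \<open>s\<close> with slope \<open>2 v \<bullet> B w\<close>.  Being
  nonnegative for all \<open>s\<close>, it has slope zero, so the columns of \<open>B\<close> are orthogonal to the kernel of the
  symmetric matrix \<open>A\<close>.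
\<close>
lemma psd_four_block_range:
  assumes A: "A \<in> carrier_mat n n" and B: "B \<in> carrier_mat n m" and C: "C \<in> carrier_mat m m"
    and psd: "psd_mat (n + m) (four_block_mat A B (transpose_mat B) C)"
  shows "\<exists>X\<in>carrier_mat n m. A * X = B"
proof -
  have sym: "transpose_mat A = A"
    and nonneg: "\<And>u w. u \<in> carrier_vec n \<Longrightarrow> w \<in> carrier_vec m \<Longrightarrow>
      0 \<le> u \<bullet> (A *\<^sub>v u) + 2 * (u \<bullet> (B *\<^sub>v w)) + w \<bullet> (C *\<^sub>v w)"
    using psd psd_four_block_iff[OF A B C] by (auto simp: symmetric_mat_def)
  have ker: "v \<bullet> (B *\<^sub>v w) = 0"
    if v: "v \<in> carrier_vec n" "A *\<^sub>v v = 0\<^sub>v n" and w: "w \<in> carrier_vec m" for v w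
  proof (rule ccontr)
    assume nz: "v \<bullet> (B *\<^sub>v w) \<noteq> 0"
    \<comment> \<open>Here the affine function takes the value \<open>-1\<close>.\<close>
    let ?s = "- (w \<bullet> (C *\<^sub>v w) + 1) / (2 * (v \<bullet> (B *\<^sub>v w)))"
    have "A *\<^sub>v (?s \<cdot>\<^sub>v v) = 0\<^sub>v n"
      using A v by (auto simp: mult_mat_vec intro!: eq_vecI)
    then have "0 \<le> 2 * (?s * (v \<bullet> (B *\<^sub>v w))) + w \<bullet> (C *\<^sub>v w)"
      using nonneg[of "?s \<cdot>\<^sub>v v" w] v w B by simp
    moreover have "2 * (?s * (v \<bullet> (B *\<^sub>v w))) = - (w \<bullet> (C *\<^sub>v w) + 1)"
      using nz by simp
    ultimately show False by linarith
  qed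
  have "\<exists>u\<in>carrier_vec n. A *\<^sub>v u = col B j" if j: "j < m" for j
  proof -
    have e: "B *\<^sub>v unit_vec m j = col B j"
      using B j by (intro eq_vecI) auto
    have "\<exists>u\<in>carrier_vec n. transpose_mat A *\<^sub>v u = col B j"
    proof (rule kernel_orthogonal_imp_range[OF A])
      show "col B j \<bullet> v = 0" if "v \<in> carrier_vec n" "A *\<^sub>v v = 0\<^sub>v n" for v
        using ker[OF that, of "unit_vec m j"] that B j
        by (simp add: e comm_scalar_prod[of v n])
    qed (use B j in auto)
    then show ?thesis by (simp add: sym)
  qed
  then obtain u where u: "\<And>j. j < m \<Longrightarrow> u j \<in> carrier_vec n \<and> A *\<^sub>v u j = col B j" by metis
  define X where "X = mat n m (\<lambda>(i, j). u j $ i)"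
  have X: "X \<in> carrier_mat n m" by (simp add: X_def)
  have col: "col X j = u j" if "j < m" for j
    using u[OF that] that by (auto simp: X_def intro!: eq_vecI)
  have "A * X = B"
  proof (rule mat_col_eqI)
    fix j assume "j < dim_col B"
    then show "col (A * X) j = col B j"
      using u[of j] col[of j] B by (simp add: col_mult2[OF A X])
  qed (use A B X in auto)
  with X show ?thesis by blast
qed

lemma quadratic_form_congruence:
  fixes A X :: "real mat"
  assumes A: "A \<in> carrier_mat n n" and X: "X \<in> carrier_mat n m" and w: "w \<in> carrier_vec m"
  shows "w \<bullet> ((transpose_mat X * A * X) *\<^sub>v w) = (X *\<^sub>v w) \<bullet> (A *\<^sub>v (X *\<^sub>v w))"
proof -
  have "(transpose_mat X * A * X) *\<^sub>v w = transpose_mat X *\<^sub>v (A *\<^sub>v (X *\<^sub>v w))"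
    using assms
    by (simp add: assoc_mult_mat_vec[of _ m n _ m] assoc_mult_mat_vec[of _ n n _ m])
  then show ?thesis
    using transpose_vec_mult_scalar[OF X w, of "A *\<^sub>v (X *\<^sub>v w)"] assms
    by (simp add: comm_scalar_prod[of _ m] comm_scalar_prod[of _ n])
qed

lemma symmetric_congruence:
  assumes A: "symmetric_mat n A" and X: "X \<in> carrier_mat n m"
  shows "symmetric_mat m (transpose_mat X * A * X)"
  using assms
  by (auto simp: symmetric_mat_def transpose_mult[of _ m n _ m] transpose_mult[of _ n n _ m]
      assoc_mult_mat[of _ m n _ n _ m])

lemma bilinear_form_symmetric:
  fixes A :: "real mat"
  assumes A: "symmetric_mat n A" and u: "u \<in> carrier_vec n" and v: "v \<in> carrier_vec n"
  shows "v \<bullet> (A *\<^sub>v u) = u \<bullet> (A *\<^sub>v v)"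
  using transpose_vec_mult_scalar[of A n n u v] assms
  by (auto simp: symmetric_mat_def comm_scalar_prod[of _ n])

text \<open>
  With off-diagonal block \<open>A X\<close>, the corner \<open>X\<^sup>T A X\<close> is exactly what turns the quadratic form into that
  of \<open>A\<close> at \<open>u + X w\<close>.  Any other corner only adds the form of its excess over \<open>X\<^sup>T A X\<close>; both directions
  of the Schur complement criterion below rest on this.
\<close>
lemma quadratic_form_square_completion:
  fixes A X :: "real mat"
  assumes A: "symmetric_mat n A" and X: "X \<in> carrier_mat n m"
    and u: "u \<in> carrier_vec n" and w: "w \<in> carrier_vec m"
  shows "u \<bullet> (A *\<^sub>v u) + 2 * (u \<bullet> ((A * X) *\<^sub>v w)) + w \<bullet> ((transpose_mat X * A * X) *\<^sub>v w)
    = (u + X *\<^sub>v w) \<bullet> (A *\<^sub>v (u + X *\<^sub>v w))"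
proof -
  have Ac: "A \<in> carrier_mat n n" using A by (simp add: symmetric_mat_def)
  have Xw: "X *\<^sub>v w \<in> carrier_vec n" using X w by simp
  show ?thesis
    using bilinear_form_symmetric[OF A u Xw] Ac X u w Xw quadratic_form_congruence[OF Ac X w]
    by (simp add: assoc_mult_mat_vec[of _ n n _ m] mult_add_distrib_mat_vec[of _ n n]
        scalar_prod_add_distrib[of _ n] add_scalar_prod_distrib[of _ n])
qed

lemma quadratic_form_minus:
  fixes M N :: "real mat"
  assumes "M \<in> carrier_mat m m" "N \<in> carrier_mat m m" "w \<in> carrier_vec m"
  shows "w \<bullet> ((M - N) *\<^sub>v w) = w \<bullet> (M *\<^sub>v w) - w \<bullet> (N *\<^sub>v w)"
  using assms by (simp add: minus_mult_distrib_mat_vec[of _ m m] scalar_prod_minus_distrib[of _ m])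

lemma schur_complement_psd:
  assumes A: "A \<in> carrier_mat n n" and X: "X \<in> carrier_mat n m" and C: "C \<in> carrier_mat m m"
    and psd: "psd_mat (n + m) (four_block_mat A (A * X) (transpose_mat (A * X)) C)"
  shows "psd_mat m (C - transpose_mat X * A * X)"
proof -
  have AX: "A * X \<in> carrier_mat n m" using A X by simp
  note iff = psd_four_block_iff[OF A AX C]
  have sA: "symmetric_mat n A" and sC: "symmetric_mat m C" using psd iff by auto
  have sS: "symmetric_mat m (transpose_mat X * A * X)" by (rule symmetric_congruence[OF sA X])
  have "0 \<le> w \<bullet> ((C - transpose_mat X * A * X) *\<^sub>v w)" if w: "w \<in> carrier_vec m" for w
  proof -
    \<comment> \<open>The minimiser in \<open>u\<close>, at which the completed square vanishes.\<close>
    let ?u = "- (X *\<^sub>v w)"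
    have u: "?u \<in> carrier_vec n" using X w by simp
    have z: "?u + X *\<^sub>v w = 0\<^sub>v n" using X w by (simp add: uminus_l_inv_vec[of _ n])
    have "0 \<le> ?u \<bullet> (A *\<^sub>v ?u) + 2 * (?u \<bullet> ((A * X) *\<^sub>v w)) + w \<bullet> (C *\<^sub>v w)"
      using psd iff u w by blast
    moreover have "?u \<bullet> (A *\<^sub>v ?u) + 2 * (?u \<bullet> ((A * X) *\<^sub>v w))
        + w \<bullet> ((transpose_mat X * A * X) *\<^sub>v w) = 0"
      using quadratic_form_square_completion[OF sA X u w] A by (simp add: z)
    ultimately show ?thesis
      using sS C w by (simp add: quadratic_form_minus symmetric_mat_def)
  qed
  moreover have "symmetric_mat m (C - transpose_mat X * A * X)"
    using sC sS by (auto simp: symmetric_mat_def transpose_minus intro!: minus_carrier_mat)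
  ultimately show ?thesis by (simp add: psd_mat_def)
qed

lemma psd_four_block_completion:
  assumes A: "psd_mat n A" and X: "X \<in> carrier_mat n m" and C: "C \<in> carrier_mat m m"
    and S: "psd_mat m (C - transpose_mat X * A * X)"
  shows "psd_mat (n + m) (four_block_mat A (A * X) (transpose_mat (A * X)) C)"
proof -
  have sA: "symmetric_mat n A" and Ac: "A \<in> carrier_mat n n"
    using A by (auto simp: psd_mat_def symmetric_mat_def)
  have AX: "A * X \<in> carrier_mat n m" using Ac X by simp
  have sS: "symmetric_mat m (transpose_mat X * A * X)" by (rule symmetric_congruence[OF sA X])
  have "C = (C - transpose_mat X * A * X) + transpose_mat X * A * X"
    using C sS by (intro eq_matI) (auto simp: symmetric_mat_def)
  moreover have "symmetric_mat m \<dots>"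
    using S sS by (auto simp: psd_mat_def symmetric_mat_def transpose_add[of _ m m])
  ultimately have sC: "symmetric_mat m C" by simp
  have "0 \<le> u \<bullet> (A *\<^sub>v u) + 2 * (u \<bullet> ((A * X) *\<^sub>v w)) + w \<bullet> (C *\<^sub>v w)"
    if u: "u \<in> carrier_vec n" and w: "w \<in> carrier_vec m" for u w
  proof -
    have "0 \<le> (u + X *\<^sub>v w) \<bullet> (A *\<^sub>v (u + X *\<^sub>v w))"
      using A X u w by (simp add: psd_mat_def)
    moreover have "0 \<le> w \<bullet> ((C - transpose_mat X * A * X) *\<^sub>v w)"
      using S w by (simp add: psd_mat_def)
    ultimately show ?thesis
      using quadratic_form_square_completion[OF sA X u w] sS C w
      by (simp add: quadratic_form_minus symmetric_mat_def)
  qed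
  with sA sC show ?thesis by (simp add: psd_four_block_iff[OF Ac AX C])
qed

section \<open>Sums of matrices\<close>

lemma mat_sum_carrier [simp]: "mat_sum r c M K \<in> carrier_mat r c"
  by (simp add: mat_sum_def)

lemma mat_sum_dim [simp]:
  "dim_row (mat_sum r c M K) = r" "dim_col (mat_sum r c M K) = c"
  by (simp_all add: mat_sum_def)

lemma mat_sum_index [simp]:
  "i < r \<Longrightarrow> j < c \<Longrightarrow> mat_sum r c M K $$ (i, j) = (\<Sum>k\<in>K. M k $$ (i, j))"
  by (simp add: mat_sum_def)

lemma mat_sum_empty: "mat_sum r c M {} = 0\<^sub>m r c"
  by (auto intro!: eq_matI)

lemma mat_sum_insert:
  "finite K \<Longrightarrow> k \<notin> K \<Longrightarrow> M k \<in> carrier_mat r c \<Longrightarrow>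
     mat_sum r c M (insert k K) = M k + mat_sum r c M K"
  by (auto intro!: eq_matI)

lemma psd_mat_add:
  assumes "psd_mat s M" "psd_mat s N"
  shows "psd_mat s (M + N)"
  using assms
  by (auto simp: psd_mat_def symmetric_mat_def transpose_add[of _ s s]
      add_mult_distrib_mat_vec[of _ s s] scalar_prod_add_distrib[of _ s])

lemma psd_zero_mat: "psd_mat s (0\<^sub>m s s)"
  by (auto simp: psd_mat_def symmetric_mat_def scalar_prod_def)

lemma psd_mat_sum:
  assumes "finite K" "\<And>k. k \<in> K \<Longrightarrow> psd_mat s (M k)"
  shows "psd_mat s (mat_sum s s M K)"
  using assms
proof (induction K rule: finite_induct)
  case empty
  show ?case unfolding mat_sum_empty by (rule psd_zero_mat)
next
  case (insert k K)
  then have "M k \<in> carrier_mat s s" by (simp add: psd_mat_def symmetric_mat_def)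
  with insert show ?case by (simp add: mat_sum_insert psd_mat_add)
qed

lemma mat_sum_cong:
  "(\<And>k. k \<in> K \<Longrightarrow> M k = N k) \<Longrightarrow> mat_sum r c M K = mat_sum r c N K"
  by (auto intro!: eq_matI sum.cong)

lemma mat_sum_four_block:
  assumes "\<And>k. k \<in> K \<Longrightarrow> A k \<in> carrier_mat n n" "\<And>k. k \<in> K \<Longrightarrow> B k \<in> carrier_mat n m"
    "\<And>k. k \<in> K \<Longrightarrow> C k \<in> carrier_mat m m"
  shows "mat_sum (n + m) (n + m) (\<lambda>k. four_block_mat (A k) (B k) (transpose_mat (B k)) (C k)) K
    = four_block_mat (mat_sum n n A K) (mat_sum n m B K) (transpose_mat (mat_sum n m B K))
        (mat_sum m m C K)"
  using assms
  by (intro eq_matI) (auto intro!: sum.cong simp: carrier_matD[OF assms(1)] carrier_matD[OF assms(2)] carrier_matD[OF assms(3)])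

lemma mat_sum_mult_right:
  assumes "finite K" "\<And>k. k \<in> K \<Longrightarrow> M k \<in> carrier_mat r q" "X \<in> carrier_mat q c"
  shows "mat_sum r c (\<lambda>k. M k * X) K = mat_sum r q M K * X"
  using assms
proof (induction K rule: finite_induct)
  case empty
  then show ?case by (simp add: mat_sum_empty)
next
  case (insert k K)
  have Mk: "M k \<in> carrier_mat r q" "M k * X \<in> carrier_mat r c"
    using insert.prems(1)[of k] mult_carrier_mat[OF _ insert.prems(2), of "M k"] by auto
  have "mat_sum r c (\<lambda>k. M k * X) (insert k K) = M k * X + mat_sum r q M K * X"
    using insert Mk by (simp add: mat_sum_insert)
  also have "\<dots> = (M k + mat_sum r q M K) * X"
    using add_mult_distrib_mat[OF Mk(1) mat_sum_carrier insert.prems(2), of M K] by simp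
  finally show ?case using insert.hyps Mk by (simp add: mat_sum_insert)
qed

lemma mat_sum_mult_left:
  assumes "finite K" "\<And>k. k \<in> K \<Longrightarrow> M k \<in> carrier_mat q c" "X \<in> carrier_mat r q"
  shows "mat_sum r c (\<lambda>k. X * M k) K = X * mat_sum q c M K"
  using assms
proof (induction K rule: finite_induct)
  case empty
  then show ?case by (simp add: mat_sum_empty)
next
  case (insert k K)
  have Mk: "M k \<in> carrier_mat q c" "X * M k \<in> carrier_mat r c" using insert.prems by auto
  have "mat_sum r c (\<lambda>k. X * M k) (insert k K) = X * M k + X * mat_sum q c M K"
    using insert Mk by (simp add: mat_sum_insert)
  also have "\<dots> = X * (M k + mat_sum q c M K)"
    using mult_add_distrib_mat[OF insert.prems(2) Mk(1) mat_sum_carrier, of M K] by simp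
  finally show ?case using insert.hyps Mk by (simp add: mat_sum_insert)
qed

section \<open>The coupling matrices\<close>

lemma rank_inj_on:
  assumes fin: "finite S"
  shows "inj_on (\<lambda>i. card {i' \<in> S. i' < (i::nat)}) S"
proof -
  have less: "card {i' \<in> S. i' < i} < card {i' \<in> S. i' < j}" if "i < j" "i \<in> S" for i j
    using that fin by (intro psubset_card_mono) auto
  show ?thesis
  proof (rule inj_onI)
    fix i j
    assume "i \<in> S" "j \<in> S" "card {i' \<in> S. i' < i} = card {i' \<in> S. i' < j}"
    then show "i = j"
      using less[of i j] less[of j i] by (cases i j rule: linorder_cases) auto
  qed
qed

lemma block_position_bounds:
  assumes "finite (overlap I kl)" "i \<in> overlap I kl"
  shows "block_offset I ps kl \<le> block_position I ps kl i"
    "block_position I ps kl i < block_offset I ps kl + card (overlap I kl)"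
  using rank_less_card[OF assms] by (auto simp: block_position_def)

lemma block_position_inj:
  assumes fin: "\<And>kl. kl \<in> set ps \<Longrightarrow> finite (overlap I kl)"
  shows "inj_on (\<lambda>(kl, i). block_position I ps kl i) (Sigma (set ps) (overlap I))"
proof (rule inj_onI)
  fix z z'
  assume z: "z \<in> Sigma (set ps) (overlap I)" "z' \<in> Sigma (set ps) (overlap I)"
    and eq: "(\<lambda>(kl, i). block_position I ps kl i) z = (\<lambda>(kl, i). block_position I ps kl i) z'"
  obtain q i q' i' where zz: "z = (q, i)" "z' = (q', i')" by (cases z, cases z') auto
  with z have q: "q \<in> set ps" "i \<in> overlap I q" and q': "q' \<in> set ps" "i' \<in> overlap I q'" by auto
  have pos: "block_position I ps q i = block_position I ps q' i'" using eq zz by simp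
  have same: "q = q'"
  proof (rule ccontr)
    assume "q \<noteq> q'"
    from block_offset_disjoint[OF q(1) q'(1) this, of I] pos show False
      using block_position_bounds[OF fin[OF q(1)] q(2), of ps]
        block_position_bounds[OF fin[OF q'(1)] q'(2), of ps] by linarith
  qed
  with pos have "card {j \<in> overlap I q. j < i} = card {j \<in> overlap I q. j < i'}"
    by (simp add: block_position_def)
  with rank_inj_on[OF fin[OF q(1)]] q(2) q'(2) same have "i = i'"
    by (auto dest: inj_onD)
  with same zz show "z = z'" by simp
qed

text \<open>
  The blocks of \<open>D\<close> are free parameters: since \<open>block_position\<close> assigns distinct rows of \<open>D\<close> to distinct
  pairs of a block and a row in its overlap, any family of entries on the overlaps can be read back
  from a suitable \<open>D\<close>.
\<close>
lemma expanded_blocks_prescribed: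
  assumes ps: "pair_order p ps" and I: "\<And>k. k \<in> {1..p} \<Longrightarrow> I k \<subseteq> {..<n}"
  shows "\<exists>D\<in>carrier_mat (overlap_total I p) m. \<forall>kl\<in>set ps. \<forall>i<n. \<forall>j<m.
    expanded_block n m I ps D kl $$ (i, j) = (if i \<in> overlap I kl then F kl i j else 0)"
proof -
  let ?pos = "\<lambda>(kl, i). block_position I ps kl i" and ?Z = "Sigma (set ps) (overlap I)"
  have fin: "finite (overlap I kl)" if "kl \<in> set ps" for kl
  proof -
    have "overlap I kl \<subseteq> {..<n}"
      using that ps I[of "fst kl"] by (auto simp: pair_order_def overlap_def)
    then show ?thesis by (rule finite_subset) simp
  qed
  have inj: "inj_on ?pos ?Z" by (rule block_position_inj[OF fin])
  define D where "D = mat (overlap_total I p) m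
    (\<lambda>(c, j). case inv_into ?Z ?pos c of (kl, i) \<Rightarrow> F kl i j)"
  have "expanded_block n m I ps D kl $$ (i, j) = F kl i j"
    if kl: "kl \<in> set ps" and i: "i \<in> overlap I kl" and ij: "i < n" "j < m" for kl i j
  proof -
    have "inv_into ?Z ?pos (?pos (kl, i)) = (kl, i)"
      using inj kl i by (intro inv_into_f_f) auto
    moreover have "block_position I ps kl i < overlap_total I p"
      using block_position_bounds[OF fin[OF kl] i, of ps] block_offset_bound[OF kl, of I]
      by (simp add: overlap_total_sum_list[OF ps])
    ultimately have "D $$ (block_position I ps kl i, j) = F kl i j"
      using ij by (simp add: D_def)
    then show ?thesis
      using i ij rank_less_card[OF fin[OF kl] i]
      by (simp add: expanded_block_def compressed_block_def block_position_def)
  qed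
  then have "\<forall>kl\<in>set ps. \<forall>i<n. \<forall>j<m.
    expanded_block n m I ps D kl $$ (i, j) = (if i \<in> overlap I kl then F kl i j else 0)"
    by (auto simp: expanded_block_def)
  moreover have "D \<in> carrier_mat (overlap_total I p) m" by (simp add: D_def)
  ultimately show ?thesis by blast
qed

lemma coupling_mat_index:
  assumes "coupling_mat n m p I ps k P" "D \<in> carrier_mat (overlap_total I p) m" "i < n" "j < m"
  shows "(P * D) $$ (i, j) = (\<Sum>l\<in>{k<..p}. expanded_block n m I ps D (k, l) $$ (i, j))
    - (\<Sum>l\<in>{1..<k}. expanded_block n m I ps D (l, k) $$ (i, j))"
  using assms by (simp add: coupling_mat_def)

text \<open>
  The block for the pair \<open>k < l\<close> is counted once positively, in the term of \<open>k\<close>, and once negatively,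
  in the term of \<open>l\<close>.
\<close>
lemma coupling_mats_sum_zero:
  assumes coupling: "\<And>k. k \<in> {1..p} \<Longrightarrow> coupling_mat n m p I ps k (P k)"
    and D: "D \<in> carrier_mat (overlap_total I p) m"
  shows "mat_sum n m (\<lambda>k. P k * D) {1..p} = 0\<^sub>m n m"
proof (rule eq_matI)
  fix i j assume "i < dim_row (0\<^sub>m n m :: real mat)" "j < dim_col (0\<^sub>m n m :: real mat)"
  then have ij: "i < n" "j < m" by auto
  let ?d = "\<lambda>k l. expanded_block n m I ps D (k, l) $$ (i, j)"
  have "(\<Sum>k\<in>{1..p}. \<Sum>l\<in>{k<..p}. ?d k l) = (\<Sum>k\<in>{1..p}. \<Sum>l\<in>{l \<in> {1..p}. k < l}. ?d k l)"
    by (intro sum.cong) auto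
  also have "\<dots> = (\<Sum>l\<in>{1..p}. \<Sum>k\<in>{k \<in> {1..p}. k < l}. ?d k l)"
    by (rule sum.swap_restrict) auto
  also have "\<dots> = (\<Sum>k\<in>{1..p}. \<Sum>l\<in>{1..<k}. ?d l k)"
    by (intro sum.cong) auto
  finally have "(\<Sum>k\<in>{1..p}. (\<Sum>l\<in>{k<..p}. ?d k l) - (\<Sum>l\<in>{1..<k}. ?d l k)) = 0"
    by (simp add: sum_subtractf)
  moreover have "(P k * D) $$ (i, j) = (\<Sum>l\<in>{k<..p}. ?d k l) - (\<Sum>l\<in>{1..<k}. ?d l k)"
    if "k \<in> {1..p}" for k
    by (rule coupling_mat_index[OF coupling[OF that] D ij])
  ultimately show "mat_sum n m (\<lambda>k. P k * D) {1..p} $$ (i, j) = 0\<^sub>m n m $$ (i, j)"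
    using ij by simp
qed auto

text \<open>
  For each row \<open>i\<close>, the least index \<open>hub i\<close> of a block supporting \<open>i\<close> exchanges the demand of every other
  such block \<open>l\<close> directly with it, through the block of \<open>D\<close> for the pair \<open>(hub i, l)\<close>; all other blocks
  of \<open>D\<close> vanish in row \<open>i\<close>.  Then the demand at the hub is met too, because the demands sum to zero.
\<close>
lemma coupling_mats_realize:
  assumes ps: "pair_order p ps" and I: "\<And>k. k \<in> {1..p} \<Longrightarrow> I k \<subseteq> {..<n}"
    and coupling: "\<And>k. k \<in> {1..p} \<Longrightarrow> coupling_mat n m p I ps k (P k)"
    and E: "\<And>k. k \<in> {1..p} \<Longrightarrow> E k \<in> carrier_mat n m"
    and supp: "\<And>k i j. k \<in> {1..p} \<Longrightarrow> i < n \<Longrightarrow> i \<notin> I k \<Longrightarrow> j < m \<Longrightarrow> E k $$ (i, j) = 0"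
    and zero: "mat_sum n m E {1..p} = 0\<^sub>m n m"
  shows "\<exists>D\<in>carrier_mat (overlap_total I p) m. \<forall>k\<in>{1..p}. P k * D = E k"
proof -
  define hub where "hub i = Min {k \<in> {1..p}. i \<in> I k}" for i
  \<comment> \<open>Block \<open>l\<close> is the larger index of the pair, where \<open>D\<close> enters with a minus sign; hence \<open>- E l\<close>.\<close>
  define F where "F = (\<lambda>(k, l) i j. if k = hub i then - E l $$ (i, j) else 0)"
  obtain D where D: "D \<in> carrier_mat (overlap_total I p) m"
    and DF: "\<And>kl i j. kl \<in> set ps \<Longrightarrow> i < n \<Longrightarrow> j < m \<Longrightarrow>
      expanded_block n m I ps D kl $$ (i, j) = (if i \<in> overlap I kl then F kl i j else 0)"
    using expanded_blocks_prescribed[where F = F and m = m and I = I, OF ps I] by blast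
  have "P k * D = E k" if k: "k \<in> {1..p}" for k
  proof (rule eq_matI)
    have "P k \<in> carrier_mat n (overlap_total I p)" using coupling[OF k] by (simp add: coupling_mat_def)
    then show "dim_row (P k * D) = dim_row (E k)" "dim_col (P k * D) = dim_col (E k)"
      using D E[OF k] by auto
    fix i j assume "i < dim_row (E k)" "j < dim_col (E k)"
    then have ij: "i < n" "j < m" using E[OF k] by auto
    have e: "expanded_block n m I ps D (a, b) $$ (i, j)
        = (if i \<in> I a \<and> i \<in> I b \<and> a = hub i then - E b $$ (i, j) else 0)"
      if "1 \<le> a" "a < b" "b \<le> p" for a b
      using DF[of "(a, b)" i j] that ps ij by (auto simp: pair_order_def overlap_def F_def)
    have PD: "(P k * D) $$ (i, j)
        = (\<Sum>l\<in>{k<..p}. if i \<in> I k \<and> i \<in> I l \<and> k = hub i then - E l $$ (i, j) else 0)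
        - (\<Sum>l\<in>{1..<k}. if i \<in> I l \<and> i \<in> I k \<and> l = hub i then - E k $$ (i, j) else 0)"
      unfolding coupling_mat_index[OF coupling[OF k] D ij]
      using k by (intro arg_cong2[where f = "(-)"] sum.cong) (auto simp: e)
    show "(P k * D) $$ (i, j) = E k $$ (i, j)"
    proof (cases "i \<in> I k")
      case False
      then show ?thesis using supp[OF k ij(1) False ij(2)] by (simp add: PD)
    next
      case True
      have "hub i \<in> {k \<in> {1..p}. i \<in> I k}"
        unfolding hub_def by (rule Min_in) (use True k in auto)
      moreover have hub_le: "hub i \<le> l" if "l \<in> {1..p}" "i \<in> I l" for l
        unfolding hub_def by (rule Min_le) (use that in auto)
      ultimately have hub: "hub i \<in> {1..p}" "i \<in> I (hub i)" "hub i \<le> k"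
        using True k by auto
      show ?thesis
      proof (cases "k = hub i")
        case k_hub: True
        have "0 = (\<Sum>l\<in>{1..p}. E l $$ (i, j))"
          using arg_cong[OF zero, of "\<lambda>M. M $$ (i, j)"] ij by simp
        also have "\<dots> = (\<Sum>l\<in>insert k {k<..p}. E l $$ (i, j))"
        proof (rule sum.mono_neutral_right)
          show "\<forall>l\<in>{1..p} - insert k {k<..p}. E l $$ (i, j) = 0"
          proof
            fix l assume l: "l \<in> {1..p} - insert k {k<..p}"
            then have "i \<notin> I l" using hub_le[of l] k_hub by auto
            with l supp ij show "E l $$ (i, j) = 0" by auto
          qed
        qed (use k in auto)
        finally have "E k $$ (i, j) = (\<Sum>l\<in>{k<..p}. - E l $$ (i, j))"
          by (simp add: sum_negf)
        also have "\<dots> = (P k * D) $$ (i, j)"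
          unfolding PD using k_hub True ij supp k
          by (auto simp: sum_negf[symmetric] intro!: sum.cong)
        finally show ?thesis by simp
      next
        case False
        have "(\<Sum>l\<in>{1..<k}. if i \<in> I l \<and> i \<in> I k \<and> l = hub i then - E k $$ (i, j) else 0)
            = (\<Sum>l\<in>{1..<k}. if l = hub i then - E k $$ (i, j) else 0)"
          by (rule sum.cong) (use hub True in auto)
        also have "\<dots> = - E k $$ (i, j)" using False hub by simp
        finally show ?thesis unfolding PD using False by simp
      qed
    qed
  qed
  with D show ?thesis by blast
qed

section \<open>Arrow decomposition at a point\<close>

lemma arrow_mat_four_block:
  assumes "\<And>k. k \<in> {1..p} \<Longrightarrow> A k x \<in> carrier_mat n n" "\<And>k. k \<in> {1..p} \<Longrightarrow> B k x \<in> carrier_mat n m"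
    "\<Gamma> x \<in> carrier_mat m m"
  shows "arrow_mat n m p A B \<Gamma> x =
    four_block_mat (mat_sum n n (\<lambda>k. A k x) {1..p}) (mat_sum n m (\<lambda>k. B k x) {1..p})
      (transpose_mat (mat_sum n m (\<lambda>k. B k x) {1..p})) (\<Gamma> x)"
proof -
  have "mat_sum (n + m) (n + m) (\<lambda>k. arrow_block m (A k) (B k) x) {1..p}
    = four_block_mat (mat_sum n n (\<lambda>k. A k x) {1..p}) (mat_sum n m (\<lambda>k. B k x) {1..p})
      (transpose_mat (mat_sum n m (\<lambda>k. B k x) {1..p})) (mat_sum m m (\<lambda>k. 0\<^sub>m m m) {1..p})"
    unfolding arrow_block_def using assms by (intro mat_sum_four_block) auto
  then show ?thesis
    unfolding arrow_mat_def using assms by (auto intro!: eq_matI)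
qed

lemma coupled_arrow_block:
  assumes "A x \<in> carrier_mat n n" "B x \<in> carrier_mat n m" "P \<in> carrier_mat n N"
    "D \<in> carrier_mat N m" "C \<in> carrier_mat m m"
  shows "arrow_block m A B x + four_block_mat (0\<^sub>m n n) (P * D) (transpose_mat D * transpose_mat P) C
    = four_block_mat (A x) (B x + P * D) (transpose_mat (B x + P * D)) C"
proof -
  have "transpose_mat D * transpose_mat P = transpose_mat (P * D)"
    using assms by (simp add: transpose_mult)
  then show ?thesis
    using assms by (auto simp: arrow_block_def intro!: eq_matI)
qed

text \<open>
  The last block loses its special role once its corner \<open>\<Gamma>(x) - \<Sum>\<^sub>k C\<^sub>k\<close> is named \<open>C\<^sub>p\<close>: the corners are then
  any matrices with sum \<open>\<Gamma>(x)\<close>, whose symmetry follows from that of the blocks.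
\<close>
lemma AD_feasible_iff:
  assumes arrow: "arrow_data n m p A B \<Gamma>"
    and coupling: "\<forall>k\<in>{1..p}. coupling_mat n m p (\<lambda>k. row_support n (A k)) ps k (Pm k)"
    and D: "D \<in> carrier_mat (overlap_total (\<lambda>k. row_support n (A k)) p) m"
  shows "(\<exists>C. AD_feasible n m p A B \<Gamma> Pm x D C) \<longleftrightarrow>
    (\<exists>C. (\<forall>k\<in>{1..p}. C k \<in> carrier_mat m m) \<and> mat_sum m m C {1..p} = \<Gamma> x \<and>
      (\<forall>k\<in>{1..p}. psd_mat (n + m) (four_block_mat (A k x) (B k x + Pm k * D)
         (transpose_mat (B k x + Pm k * D)) (C k))))"
  (is "?L \<longleftrightarrow> ?R")
proof -
  let ?Q = "\<lambda>k C. four_block_mat (A k x) (B k x + Pm k * D) (transpose_mat (B k x + Pm k * D)) C"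
  have p: "1 \<le> p" "{1..p} = insert p {1..<p}" using arrow by (auto simp: arrow_data_def)
  have Ac: "A k x \<in> carrier_mat n n" and Bc: "B k x \<in> carrier_mat n m"
    and Pc: "Pm k \<in> carrier_mat n (overlap_total (\<lambda>k. row_support n (A k)) p)" if "k \<in> {1..p}" for k
    using that arrow coupling
    by (auto simp: arrow_data_def symmetric_matrix_polynomial_def matrix_polynomial_def coupling_mat_def)
  have \<Gamma>c: "\<Gamma> x \<in> carrier_mat m m"
    using arrow by (auto simp: arrow_data_def symmetric_matrix_polynomial_def matrix_polynomial_def)
  have block: "arrow_block m (A k) (B k) x
      + four_block_mat (0\<^sub>m n n) (Pm k * D) (transpose_mat D * transpose_mat (Pm k)) C = ?Q k C"
    if "k \<in> {1..p}" "C \<in> carrier_mat m m" for k C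
    using coupled_arrow_block[where A = "A k" and B = "B k"] Ac Bc Pc D that by blast
  have last: "\<Gamma> x - mat_sum m m C {1..<p} \<in> carrier_mat m m" for C
    by (rule minus_carrier_mat) simp
  show ?thesis
  proof
    assume ?L
    then obtain C where C: "AD_feasible n m p A B \<Gamma> Pm x D C" by blast
    define C' where "C' = C(p := \<Gamma> x - mat_sum m m C {1..<p})"
    have Cc: "C' k \<in> carrier_mat m m" if "k \<in> {1..p}" for k
      using that C p last by (auto simp: C'_def AD_feasible_def symmetric_mat_def)
    have "mat_sum m m C' {1..<p} = mat_sum m m C {1..<p}"
      by (rule mat_sum_cong) (simp add: C'_def)
    then have "mat_sum m m C' {1..p} = (\<Gamma> x - mat_sum m m C {1..<p}) + mat_sum m m C {1..<p}"
      unfolding p(2) by (subst mat_sum_insert) (use last in \<open>auto simp: C'_def\<close>)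
    also have "\<dots> = \<Gamma> x" using \<Gamma>c by (intro eq_matI) auto
    finally have "mat_sum m m C' {1..p} = \<Gamma> x" .
    moreover have "psd_mat (n + m) (?Q k (C' k))" if k: "k \<in> {1..p}" for k
    proof (cases "k = p")
      case True
      then show ?thesis using C block[OF k Cc[OF k]] by (simp add: C'_def AD_feasible_def)
    next
      case False
      then have "k \<in> {1..<p}" using k by simp
      with C False show ?thesis
        unfolding block[OF k Cc[OF k], symmetric] by (simp add: C'_def AD_feasible_def)
    qed
    ultimately show ?R using Cc by blast
  next
    assume ?R
    then obtain C where Cc: "\<And>k. k \<in> {1..p} \<Longrightarrow> C k \<in> carrier_mat m m"
      and sum: "mat_sum m m C {1..p} = \<Gamma> x"
      and psd: "\<And>k. k \<in> {1..p} \<Longrightarrow> psd_mat (n + m) (?Q k (C k))" by blast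
    have "\<Gamma> x = C p + mat_sum m m C {1..<p}"
      using sum Cc[of p] p(1) unfolding p(2) by (simp add: mat_sum_insert)
    then have Cp: "\<Gamma> x - mat_sum m m C {1..<p} = C p"
      using Cc[of p] p(1) by (auto intro!: eq_matI)
    have "symmetric_mat m (C k)" if k: "k \<in> {1..p}" for k
      using psd[OF k] psd_four_block_iff[of "A k x" n "B k x + Pm k * D" m "C k"]
        Ac[OF k] Bc[OF k] Pc[OF k] Cc[OF k] D by auto
    moreover have "psd_mat (n + m) (arrow_block m (A k) (B k) x
      + four_block_mat (0\<^sub>m n n) (Pm k * D) (transpose_mat D * transpose_mat (Pm k)) (C k))"
      if k: "k \<in> {1..p}" for k
      using psd[OF k] block[OF k Cc[OF k]] by simp
    ultimately have "AD_feasible n m p A B \<Gamma> Pm x D C"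
      using D p(1) unfolding AD_feasible_def Cp by simp
    then show ?L by blast
  qed
qed

lemma AD_feasible_imp_psd:
  assumes arrow: "arrow_data n m p A B \<Gamma>"
    and coupling: "\<forall>k\<in>{1..p}. coupling_mat n m p (\<lambda>k. row_support n (A k)) ps k (Pm k)"
    and feas: "AD_feasible n m p A B \<Gamma> Pm x D C"
  shows "psd_mat (n + m) (arrow_mat n m p A B \<Gamma> x)"
proof -
  let ?N = "overlap_total (\<lambda>k. row_support n (A k)) p"
  have D: "D \<in> carrier_mat ?N m" using feas by (simp add: AD_feasible_def)
  obtain C where Cc: "\<And>k. k \<in> {1..p} \<Longrightarrow> C k \<in> carrier_mat m m"
    and sum: "mat_sum m m C {1..p} = \<Gamma> x"
    and psd: "\<And>k. k \<in> {1..p} \<Longrightarrow> psd_mat (n + m) (four_block_mat (A k x) (B k x + Pm k * D)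
         (transpose_mat (B k x + Pm k * D)) (C k))"
    using feas AD_feasible_iff[OF arrow coupling D, of x] by blast
  have Ac: "A k x \<in> carrier_mat n n" and Bc: "B k x \<in> carrier_mat n m"
    and Pc: "Pm k \<in> carrier_mat n ?N" if "k \<in> {1..p}" for k
    using that arrow coupling
    by (auto simp: arrow_data_def symmetric_matrix_polynomial_def matrix_polynomial_def coupling_mat_def)
  have \<Gamma>c: "\<Gamma> x \<in> carrier_mat m m"
    using arrow by (auto simp: arrow_data_def symmetric_matrix_polynomial_def matrix_polynomial_def)
  have Sc: "B k x + Pm k * D \<in> carrier_mat n m" if "k \<in> {1..p}" for k
    using Pc[OF that] D by simp
  have "mat_sum n m (\<lambda>k. Pm k * D) {1..p} = 0\<^sub>m n m"
    using coupling by (intro coupling_mats_sum_zero[OF _ D]) auto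
  then have PD: "(\<Sum>k\<in>{1..p}. (Pm k * D) $$ (i, j)) = 0" if "i < n" "j < m" for i j
    using that mat_sum_index[OF that, of "\<lambda>k. Pm k * D" "{1..p}"] by simp
  have "mat_sum n m (\<lambda>k. B k x + Pm k * D) {1..p} = mat_sum n m (\<lambda>k. B k x) {1..p}"
  proof (rule eq_matI)
    fix i j assume "i < dim_row (mat_sum n m (\<lambda>k. B k x) {1..p})"
      "j < dim_col (mat_sum n m (\<lambda>k. B k x) {1..p})"
    then have ij: "i < n" "j < m" by auto
    have "(\<Sum>k\<in>{1..p}. (B k x + Pm k * D) $$ (i, j))
        = (\<Sum>k\<in>{1..p}. B k x $$ (i, j) + (Pm k * D) $$ (i, j))"
    proof (rule sum.cong)
      fix k assume "k \<in> {1..p}"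
      then show "(B k x + Pm k * D) $$ (i, j) = B k x $$ (i, j) + (Pm k * D) $$ (i, j)"
        using Pc[of k] D ij by (intro index_add_mat) auto
    qed simp
    also have "\<dots> = (\<Sum>k\<in>{1..p}. B k x $$ (i, j))"
      using PD[OF ij] by (simp only: sum.distrib add_0_right)
    finally show "mat_sum n m (\<lambda>k. B k x + Pm k * D) {1..p} $$ (i, j)
        = mat_sum n m (\<lambda>k. B k x) {1..p} $$ (i, j)"
      using ij by simp
  qed auto
  then have "arrow_mat n m p A B \<Gamma> x = mat_sum (n + m) (n + m) (\<lambda>k.
      four_block_mat (A k x) (B k x + Pm k * D) (transpose_mat (B k x + Pm k * D)) (C k)) {1..p}"
    using mat_sum_four_block[of "{1..p}" "\<lambda>k. A k x" n "\<lambda>k. B k x + Pm k * D" m C]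
      arrow_mat_four_block[of p A x n B m \<Gamma>] Ac Bc \<Gamma>c Sc Cc sum by simp
  moreover have "psd_mat (n + m) \<dots>"
    by (rule psd_mat_sum) (use psd in auto)
  ultimately show ?thesis by simp
qed

text \<open>
  The off-diagonal parts \<open>A\<^sub>k(x) X\<close> inherit the row support of \<open>A\<^sub>k\<close> and sum to \<open>A X = B\<close>.  They thus differ
  from the \<open>B\<^sub>k(x)\<close> by corrections that a single \<open>D\<close> can produce.
\<close>
lemma psd_imp_AD_feasible:
  assumes arrow: "arrow_data n m p A B \<Gamma>" and order: "pair_order p ps"
    and coupling: "\<forall>k\<in>{1..p}. coupling_mat n m p (\<lambda>k. row_support n (A k)) ps k (Pm k)"
    and G: "psd_mat (n + m) (arrow_mat n m p A B \<Gamma> x)"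
    and A_psd: "\<And>k. k \<in> {1..p} \<Longrightarrow> psd_mat n (A k x)"
  shows "\<exists>D C. AD_feasible n m p A B \<Gamma> Pm x D C"
proof -
  let ?I = "\<lambda>k. row_support n (A k)"
  let ?A = "mat_sum n n (\<lambda>k. A k x) {1..p}" and ?B = "mat_sum n m (\<lambda>k. B k x) {1..p}"
  have Ac: "A k x \<in> carrier_mat n n" and Bc: "B k x \<in> carrier_mat n m" if "k \<in> {1..p}" for k
    using that arrow
    by (auto simp: arrow_data_def symmetric_matrix_polynomial_def matrix_polynomial_def)
  have \<Gamma>c: "\<Gamma> x \<in> carrier_mat m m" and p: "1 \<le> p"
    using arrow by (auto simp: arrow_data_def symmetric_matrix_polynomial_def matrix_polynomial_def)
  have G': "psd_mat (n + m) (four_block_mat ?A ?B (transpose_mat ?B) (\<Gamma> x))"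
    using G arrow_mat_four_block[of p A x n B m \<Gamma>] Ac Bc \<Gamma>c by simp
  obtain X where X: "X \<in> carrier_mat n m" and AX: "?A * X = ?B"
    using psd_four_block_range[OF _ _ \<Gamma>c G'] by auto
  define E where "E k = A k x * X - B k x" for k
  have Ec: "E k \<in> carrier_mat n m" if "k \<in> {1..p}" for k
    using Bc[OF that] unfolding E_def by (rule minus_carrier_mat)
  have "\<exists>D\<in>carrier_mat (overlap_total ?I p) m. \<forall>k\<in>{1..p}. Pm k * D = E k"
  proof (rule coupling_mats_realize[OF order])
    show "?I k \<subseteq> {..<n}" for k by (auto simp: row_support_def)
    show "E k $$ (i, j) = 0" if k: "k \<in> {1..p}" and i: "i < n" "i \<notin> ?I k" and j: "j < m" for k i j
    proof -
      have "row (A k x) i = 0\<^sub>v n"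
        using i Ac[OF k] by (auto simp: row_support_def intro!: eq_vecI)
      moreover have "B k x $$ (i, j) = 0"
        using arrow k i j by (auto simp: arrow_data_def)
      ultimately show ?thesis
        using X Ac[OF k] Bc[OF k] i j by (simp add: E_def)
    qed
    have "mat_sum n m E {1..p} = mat_sum n m (\<lambda>k. A k x * X) {1..p} - ?B"
      by (intro eq_matI) (auto simp: E_def sum_subtractf[symmetric] carrier_matD[OF Bc] intro!: sum.cong)
    also have "\<dots> = 0\<^sub>m n m"
      using mat_sum_mult_right[of "{1..p}" "\<lambda>k. A k x" n n X m] Ac X AX by auto
    finally show "mat_sum n m E {1..p} = 0\<^sub>m n m" .
  qed (use coupling Ec in auto)
  then obtain D where D: "D \<in> carrier_mat (overlap_total ?I p) m"
    and PD: "\<And>k. k \<in> {1..p} \<Longrightarrow> Pm k * D = E k" by blast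
  have BPD: "B k x + Pm k * D = A k x * X" if k: "k \<in> {1..p}" for k
    using PD[OF k] Ac[OF k] Bc[OF k] X by (auto simp: E_def intro!: eq_matI)
  \<comment> \<open>The corners \<open>X\<^sup>T A\<^sub>k X\<close> are the least possible; their sum falls short of \<open>\<Gamma>(x)\<close> by \<open>?S\<close>, which may go
    to any one block.\<close>
  let ?S = "\<Gamma> x - transpose_mat X * ?A * X"
  have S: "psd_mat m ?S"
    using schur_complement_psd[OF _ X \<Gamma>c, of ?A] G' AX by simp
  define C where "C k = transpose_mat X * A k x * X + (if k = p then ?S else 0\<^sub>m m m)" for k
  have Cc: "C k \<in> carrier_mat m m" for k
    using X by (auto simp: C_def intro!: minus_carrier_mat)
  have slack: "C k - transpose_mat X * A k x * X = (if k = p then ?S else 0\<^sub>m m m)" for k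
    using X \<Gamma>c by (auto simp: C_def intro!: eq_matI)
  have "psd_mat (n + m) (four_block_mat (A k x) (B k x + Pm k * D)
      (transpose_mat (B k x + Pm k * D)) (C k))" if k: "k \<in> {1..p}" for k
    unfolding BPD[OF k]
    using S psd_zero_mat by (intro psd_four_block_completion[OF A_psd[OF k] X Cc]) (simp add: slack)
  moreover have "mat_sum m m C {1..p} = \<Gamma> x"
  proof -
    have "mat_sum m m (\<lambda>k. transpose_mat X * A k x * X) {1..p} = transpose_mat X * ?A * X"
      using mat_sum_mult_right[of "{1..p}" "\<lambda>k. transpose_mat X * A k x" m n X m]
        mat_sum_mult_left[of "{1..p}" "\<lambda>k. A k x" n n "transpose_mat X" m] X Ac by simp
    moreover have "mat_sum m m (\<lambda>k. if k = p then ?S else 0\<^sub>m m m) {1..p} = ?S"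
    proof (rule eq_matI)
      fix i j assume "i < dim_row ?S" "j < dim_col ?S"
      then have ij: "i < m" "j < m" using X by auto
      have "(\<Sum>k\<in>{1..p}. (if k = p then ?S else 0\<^sub>m m m) $$ (i, j))
          = (\<Sum>k\<in>{1..p}. if k = p then ?S $$ (i, j) else 0)"
        using ij by (intro sum.cong) auto
      also have "\<dots> = ?S $$ (i, j)" using p by simp
      finally show "mat_sum m m (\<lambda>k. if k = p then ?S else 0\<^sub>m m m) {1..p} $$ (i, j) = ?S $$ (i, j)"
        using ij by simp
    qed (use X in auto)
    moreover have "mat_sum m m C {1..p} = mat_sum m m (\<lambda>k. transpose_mat X * A k x * X) {1..p}
        + mat_sum m m (\<lambda>k. if k = p then ?S else 0\<^sub>m m m) {1..p}"
    proof (rule eq_matI)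
      fix i j assume "i < dim_row (mat_sum m m (\<lambda>k. transpose_mat X * A k x * X) {1..p}
        + mat_sum m m (\<lambda>k. if k = p then ?S else 0\<^sub>m m m) {1..p})"
        and "j < dim_col (mat_sum m m (\<lambda>k. transpose_mat X * A k x * X) {1..p}
        + mat_sum m m (\<lambda>k. if k = p then ?S else 0\<^sub>m m m) {1..p})"
      then have ij: "i < m" "j < m" by auto
      have "C k $$ (i, j) = (transpose_mat X * A k x * X) $$ (i, j)
          + (if k = p then ?S else 0\<^sub>m m m) $$ (i, j)" for k
        unfolding C_def using ij X by (intro index_add_mat) auto
      with ij show "mat_sum m m C {1..p} $$ (i, j)
          = (mat_sum m m (\<lambda>k. transpose_mat X * A k x * X) {1..p}
            + mat_sum m m (\<lambda>k. if k = p then ?S else 0\<^sub>m m m) {1..p}) $$ (i, j)"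
        by (simp only: mat_sum_index index_add_mat mat_sum_dim sum.distrib)
    qed auto
    ultimately show ?thesis using X \<Gamma>c by (auto intro!: eq_matI)
  qed
  ultimately show ?thesis
    using AD_feasible_iff[OF arrow coupling D, of x] Cc by blast
qed

section \<open>Equality of the optimal values\<close>

theorem proposition2:
  fixes f :: "real ^ 'd \<Rightarrow> real"
    and A B :: "nat \<Rightarrow> real ^ 'd \<Rightarrow> real mat"
    and \<Gamma> :: "real ^ 'd \<Rightarrow> real mat"
    and Pm :: "nat \<Rightarrow> real mat"
    and n m p :: nat
    and ps :: "(nat \<times> nat) list"
    and K :: "(real ^ 'd) set"
  assumes f: "real_polynomial_function f"
    and arrow: "arrow_data n m p A B \<Gamma>"
    and order: "pair_order p ps"
    and coupling: "\<forall>k\<in>{1..p}. coupling_mat n m p (\<lambda>k. row_support n (A k)) ps k (Pm k)"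
    and K_def: "K = {x. psd_mat (n + m) (arrow_mat n m p A B \<Gamma> x)}"
    and K_compact: "compact K"
    and archimedean: "\<exists>p0 R. sos_polynomial p0 \<and> sos_matrix_polynomial (n + m) R \<and>
        compact {x. p0 x + trace_inner (R x) (arrow_mat n m p A B \<Gamma> x) \<ge> 0}"
    and psd_on_K: "\<forall>x\<in>K. \<forall>k\<in>{1..p}. psd_mat n (A k x) \<and> psd_mat m (\<Gamma> x)"
  shows "f_AD n m p A B \<Gamma> Pm f = (INF x\<in>K. ereal (f x)) \<and>
         (K \<noteq> {} \<longrightarrow>
           (\<exists>x\<in>K. (\<forall>y\<in>K. f x \<le> f y) \<and> f_AD n m p A B \<Gamma> Pm f = ereal (f x)))"
proof -
  have "(\<exists>D C. AD_feasible n m p A B \<Gamma> Pm x D C) \<longleftrightarrow> x \<in> K" for x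
    using AD_feasible_imp_psd[OF arrow coupling] psd_imp_AD_feasible[OF arrow order coupling]
      psd_on_K by (auto simp: K_def)
  then have "{ereal (f x) | x D C. AD_feasible n m p A B \<Gamma> Pm x D C} = (\<lambda>x. ereal (f x)) ` K"
    by blast
  then have eq: "f_AD n m p A B \<Gamma> Pm f = (INF x\<in>K. ereal (f x))"
    by (simp add: f_AD_def)
  moreover have "\<exists>x\<in>K. (\<forall>y\<in>K. f x \<le> f y) \<and> f_AD n m p A B \<Gamma> Pm f = ereal (f x)"
    if nonempty: "K \<noteq> {}"
  proof -
    have "continuous_on K f"
      using f by (intro continuous_on_polymonial_function) (simp add: real_polynomial_function_eq)
    then obtain x where x: "x \<in> K" "\<forall>y\<in>K. f x \<le> f y"
      using continuous_attains_inf[of K f] K_compact nonempty by blast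
    then have "(INF y\<in>K. ereal (f y)) = ereal (f x)"
      by (intro antisym INF_lower INF_greatest) auto
    with x eq show ?thesis by auto
  qed
  ultimately show ?thesis by blast
qed

end
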